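(* Let $\mathcal{G}(n,m)$ denote the Erdős–Rényi random graph on $n$ vertices with exactly $m$ edges, chosen uniformly at random without replacement from the $\binom{n}{2}$ possible edges. For every constant $c=\frac{m}{n}\geq 1.073$ there is a constant $\beta>0$ such that $$\lim_{n\to\infty}\Pr\big[\mathrm{tw}(\mathcal{G}(n,m))>\beta n\big]=1 .$$
   Context: $\mathrm{tw}(G)$ denotes the treewidth of $G$: the minimum $k$ such that $G$ is a subgraph of a $k$-tree, where a $k$-tree is either a clique on $k+1$ vertices or is obtained from a $k$-tree by adding a new vertex adjacent to all vertices of a $k$-clique. The edge/vertex ratio $c=m/n$ is held fixed as $n\to\infty$ (so $m=cn$). *)

theory Defs
  imports "HOL-Probability.Probability" "HOL-Library.Ramsey"
begin

text \<open>A finite simple graph is given by a vertex set \<open>V\<close> and a set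
  \<open>E \<subseteq> [V]\<^bsup>2\<^esup>\<close> of two-element sets, its edges.\<close>

inductive ktree :: "nat \<Rightarrow> 'a set \<Rightarrow> 'a set set \<Rightarrow> bool" for k :: nat where
  clique: "finite V \<Longrightarrow> card V = k + 1 \<Longrightarrow> ktree k V ([V]\<^bsup>2\<^esup>)"
| extend: "ktree k V E \<Longrightarrow> v \<notin> V \<Longrightarrow> K \<subseteq> V \<Longrightarrow> card K = k \<Longrightarrow> clique K E \<Longrightarrow>
           ktree k (insert v V) (E \<union> {{v, u} | u. u \<in> K})"

text \<open>The \<open>k\<close>-tree may have vertices outside \<open>V\<close>.\<close>

definition treewidth :: "'a set \<Rightarrow> 'a set set \<Rightarrow> nat" where
  "treewidth V E = (LEAST k. \<exists>W F. ktree k W F \<and> V \<subseteq> W \<and> E \<subseteq> F)"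

text \<open>The \<open>LEAST\<close> above is attained for every finite simple graph.\<close>

lemma ex_ktree_supergraph:
  fixes V :: "'a set"
  assumes "finite V" and "E \<subseteq> [V]\<^bsup>2\<^esup>"
  shows "\<exists>k W F. ktree k W F \<and> V \<subseteq> W \<and> E \<subseteq> F"
proof -
  define W where "W = insert undefined V"
  have "finite W" "V \<subseteq> W" "W \<noteq> {}"
    using assms(1) by (auto simp: W_def)
  then have W: "finite W" "V \<subseteq> W" "card W = (card W - 1) + 1"
    using card_gt_0_iff[of W] by auto
  have "E \<subseteq> [W]\<^bsup>2\<^esup>"
    using assms(2) nsets_mono[OF W(2)] by blast
  with ktree.clique[OF W(1,3)] W(2) show ?thesis
    by blast
qed

text \<open>The edge set of \<open>\<G>(n,m)\<close>, on the vertex set \<open>{..<n}\<close>. This is meaningful only for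
  \<open>m \<le> n choose 2\<close>; otherwise there is no graph to choose and the distribution is unspecified.\<close>

definition erdos_renyi :: "nat \<Rightarrow> nat \<Rightarrow> nat set set pmf" where
  "erdos_renyi n m = pmf_of_set {E. E \<subseteq> [{..<n}]\<^bsup>2\<^esup> \<and> card E = m}"

end

theory Submission
  imports Defs
begin

text \<open>If \<open>tw(G) \<le> k\<close>, then the connected sets with more than \<open>n/2\<close> vertices form a bramble, so some
  set \<open>S\<close> of at most \<open>k + 1\<close> vertices meets all of them. Hence \<open>G - S\<close> splits, without edges
  between different parts, either into two parts that both contain at least a fraction \<open>0.396\<close> of the
  vertices, or into three parts that each contain at most this fraction. For fixed \<open>S\<close> there are at
  most \<open>2\<^sup>n\<close> resp. \<open>3\<^sup>n\<close> such splittings, and a given one leaves a random edge a probability of at most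
  \<open>1 - 2\<alpha>(1 - \<alpha>) + o(1) < 0.522\<close> resp. \<open>1 - 2(2\<alpha> - 3\<alpha>\<^sup>2) + o(1) < 0.3574\<close>, with \<open>\<alpha> = 0.396\<close>, of not being a
  cross edge. Since \<open>1.073 > 15/14\<close>, both \<open>2\<^sup>1\<^sup>4 0.522\<^sup>1\<^sup>5\<close> and \<open>3\<^sup>1\<^sup>4 0.3574\<^sup>1\<^sup>5\<close> are below 1, and the
  union bound succeeds; the number of choices for \<open>S\<close> is absorbed by taking \<open>\<beta>\<close> small. Treating
  the three-part case separately is what brings the threshold below the value \<open>1.083\<close> that
  two-part splittings with fraction \<open>1/3\<close> would give.\<close>

section \<open>Balanced separators in graphs of small treewidth\<close>

text \<open>Connectedness is phrased by cuts instead of paths, so that a set failing it directly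
  yields a splitting without edges across.\<close>

definition connected_in :: "'a set set \<Rightarrow> 'a set \<Rightarrow> bool" where
  "connected_in E U \<longleftrightarrow> U \<noteq> {} \<and> (\<forall>A\<subseteq>U. A \<noteq> {} \<longrightarrow> A \<noteq> U \<longrightarrow> (\<exists>a\<in>A. \<exists>b\<in>U-A. {a,b} \<in> E))"

definition touching :: "'a set set \<Rightarrow> 'a set \<Rightarrow> 'a set \<Rightarrow> bool" where
  "touching E A B \<longleftrightarrow> (\<exists>a\<in>A. \<exists>b\<in>B. a = b \<or> {a,b} \<in> E)"

lemma ktree_finite: "ktree k W F \<Longrightarrow> finite W"
  by (induction rule: ktree.induct) auto

lemma ktree_edge_subset: "ktree k W F \<Longrightarrow> e \<in> F \<Longrightarrow> e \<subseteq> W"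
  by (induction arbitrary: e rule: ktree.induct) (fastforce simp: nsets_def)+

text \<open>This is the easy half of the duality between treewidth and brambles, by induction on the
  construction of the \<open>k\<close>-tree. If \<open>{v}\<close> is a member, all members touch it
  and so meet \<open>insert v K\<close>, which has \<open>k + 1\<close> elements. Otherwise deleting
  \<open>v\<close> from every member leaves a bramble of the smaller \<open>k\<close>-tree, since
  the neighbours of \<open>v\<close> form a clique.\<close>

lemma ktree_bramble_hitting_set:
  assumes "ktree k W F"
    and "\<And>B. B \<in> \<B> \<Longrightarrow> B \<subseteq> W \<and> connected_in F B"
    and "\<And>A B. A \<in> \<B> \<Longrightarrow> B \<in> \<B> \<Longrightarrow> touching F A B"
  shows "\<exists>S\<subseteq>W. card S \<le> k + 1 \<and> (\<forall>B\<in>\<B>. B \<inter> S \<noteq> {})"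
  using assms
proof (induction arbitrary: \<B> rule: ktree.induct)
  case (clique V)
  then have "B \<inter> V \<noteq> {}" if "B \<in> \<B>" for B
    using that unfolding connected_in_def by blast
  with clique.hyps show ?case by auto
next
  case (extend V E v K)
  let ?F = "E \<union> {{v, u} | u. u \<in> K}"
  have finK: "finite K"
    using ktree_finite[OF extend.hyps(1)] extend.hyps(3) finite_subset by blast
  have vK: "v \<notin> K"
    using extend.hyps by blast
  have nbr: "{v, b} \<in> ?F \<Longrightarrow> b \<in> K" for b
    using ktree_edge_subset[OF extend.hyps(1), of "{v,b}"] extend.hyps(2)
    by (auto simp: doubleton_eq_iff)
  have old: "{a, b} \<in> ?F \<Longrightarrow> a \<noteq> v \<Longrightarrow> b \<noteq> v \<Longrightarrow> {a, b} \<in> E" for a b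
    by (auto simp: doubleton_eq_iff)
  have K: "a \<in> K \<Longrightarrow> b \<in> K \<Longrightarrow> a = b \<or> {a, b} \<in> E" for a b
    using extend.hyps(5) by (auto simp: clique_def)
  show ?case
  proof (cases "{v} \<in> \<B>")
    case True
    have "B \<inter> insert v K \<noteq> {}" if B: "B \<in> \<B>" for B
    proof -
      obtain b where "b \<in> B" "v = b \<or> {v, b} \<in> ?F"
        using extend.prems(2)[OF True B] by (auto simp: touching_def)
      then show ?thesis using nbr by blast
    qed
    moreover have "card (insert v K) \<le> k + 1"
      using extend.hyps(4) vK finK by simp
    ultimately show ?thesis
      using extend.hyps(3) by (intro exI[of _ "insert v K"]) auto
  next
    case False
    have meetK: "\<exists>a\<in>B - {v}. a \<in> K" if B: "B \<in> \<B>" "v \<in> B" for B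
    proof -
      have "B \<noteq> {v}" using False B by auto
      then obtain b where "b \<in> B - {v}" "{v, b} \<in> ?F"
        using extend.prems(1)[OF B(1)] B(2) unfolding connected_in_def
        by (metis (no_types, lifting) empty_not_insert empty_subsetI insert_subset singletonD)
      then show ?thesis using nbr by blast
    qed
    \<comment> \<open>If no edge of \<open>E\<close> crosses from \<open>A\<close> to the rest of
      \<open>B - {v}\<close>, the edge leaving \<open>A\<close> in \<open>B\<close> ends in
      \<open>v\<close>, so it starts in \<open>K\<close>. The edge leaving \<open>insert v A\<close>
      must start in \<open>v\<close>, so it ends in \<open>K\<close>. These two vertices of
      \<open>K\<close> are adjacent, a contradiction.\<close>
    have conn: "connected_in E (B - {v})" if B: "B \<in> \<B>" for B
    proof -
      have cB: "\<exists>a\<in>A. \<exists>b\<in>B-A. {a,b} \<in> ?F" if "A \<subseteq> B" "A \<noteq> {}" "A \<noteq> B" for A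
        using extend.prems(1)[OF B] that unfolding connected_in_def by blast
      have "B - {v} \<noteq> {}"
        using extend.prems(1)[OF B] meetK[OF B] unfolding connected_in_def by blast
      moreover have "\<exists>a\<in>A. \<exists>b\<in>B-{v}-A. {a,b} \<in> E"
        if A: "A \<subseteq> B - {v}" "A \<noteq> {}" "A \<noteq> B - {v}" for A
      proof (rule ccontr)
        assume no: "\<not> ?thesis"
        obtain a b where ab: "a \<in> A" "b \<in> B - A" "{a,b} \<in> ?F"
          using cB[of A] A by blast
        have bv: "b = v"
        proof (rule ccontr)
          assume "b \<noteq> v"
          moreover from this have "{a,b} \<in> E" using ab A old by blast
          ultimately show False using no ab by blast
        qed
        then have aK: "a \<in> K" "v \<in> B"
          using ab nbr[of a] by (auto simp: insert_commute)
        have "insert v A \<subseteq> B" "insert v A \<noteq> {}" "insert v A \<noteq> B"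
          using A aK by auto
        then obtain a' b' where ab': "a' \<in> insert v A" "b' \<in> B - insert v A" "{a',b'} \<in> ?F"
          using cB by meson
        have "a' = v"
        proof (rule ccontr)
          assume "a' \<noteq> v"
          moreover from this have "{a',b'} \<in> E" using ab' old by blast
          ultimately show False using no ab' by blast
        qed
        then have "b' \<in> K" using ab'(3) nbr by blast
        moreover have "a \<noteq> b'" "b' \<in> B - {v} - A" using ab(1) ab'(2) by auto
        ultimately have "{a, b'} \<in> E" using K[OF aK(1)] by metis
        then show False using no ab(1) \<open>b' \<in> B - {v} - A\<close> by metis
      qed
      ultimately show ?thesis unfolding connected_in_def by blast
    qed
    \<comment> \<open>A contact that uses \<open>v\<close> is replaced by two equal or adjacent
      vertices of \<open>K\<close>.\<close>
    have touch: "touching E (A - {v}) (B - {v})" if AB: "A \<in> \<B>" "B \<in> \<B>" for A B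
    proof -
      obtain a b where ab: "a \<in> A" "b \<in> B" "a = b \<or> {a,b} \<in> ?F"
        using extend.prems(2)[OF AB] unfolding touching_def by blast
      consider "a \<noteq> v" "b \<noteq> v" | "a = v" "b = v" | "a = v" "b \<noteq> v" | "a \<noteq> v" "b = v"
        by blast
      then show ?thesis
      proof cases
        case 1
        then have "a = b \<or> {a,b} \<in> E" using ab(3) old by blast
        then show ?thesis using ab(1,2) 1 unfolding touching_def by blast
      next
        case 2
        then show ?thesis
          using meetK[OF AB(1)] meetK[OF AB(2)] ab(1,2) K unfolding touching_def by blast
      next
        case 3
        then have "b \<in> K" using ab(3) nbr by blast
        then show ?thesis
          using meetK[OF AB(1)] ab(1,2) 3 K unfolding touching_def by blast
      next
        case 4
        then have "a \<in> K" using ab(3) nbr[of a] by (simp add: insert_commute)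
        then show ?thesis
          using meetK[OF AB(2)] ab(1,2) 4 K unfolding touching_def by blast
      qed
    qed
    have "\<exists>S\<subseteq>V. card S \<le> k + 1 \<and> (\<forall>B\<in>(\<lambda>B. B - {v}) ` \<B>. B \<inter> S \<noteq> {})"
    proof (rule extend.IH)
      fix A B
      assume "B \<in> (\<lambda>B. B - {v}) ` \<B>"
      then obtain B' where B': "B' \<in> \<B>" "B = B' - {v}" by auto
      then show "B \<subseteq> V \<and> connected_in E B"
        using extend.prems(1)[OF B'(1)] conn by auto
      assume "A \<in> (\<lambda>B. B - {v}) ` \<B>"
      then obtain A' where "A' \<in> \<B>" "A = A' - {v}" by auto
      then show "touching E A B" using B' touch by simp
    qed
    then obtain S where S: "S \<subseteq> V" "card S \<le> k + 1" "\<And>B. B \<in> \<B> \<Longrightarrow> (B - {v}) \<inter> S \<noteq> {}"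
      by auto
    then have "\<forall>B\<in>\<B>. B \<inter> S \<noteq> {}" by blast
    with S(1,2) show ?thesis by blast
  qed
qed

lemma connected_in_mono: "connected_in E U \<Longrightarrow> E \<subseteq> F \<Longrightarrow> connected_in F U"
  unfolding connected_in_def by blast

text \<open>Two sets that each contain more than half of \<open>V\<close> intersect, so the
  connected ones form a bramble; a set hitting all of them leaves no large connected set.\<close>

lemma treewidth_separator:
  assumes V: "finite V" and E: "E \<subseteq> [V]\<^bsup>2\<^esup>"
  shows "\<exists>S\<subseteq>V. card S \<le> treewidth V E + 1 \<and>
    (\<forall>U\<subseteq>V-S. connected_in E U \<longrightarrow> 2 * card U \<le> card V)"
proof -
  obtain W F where W: "ktree (treewidth V E) W F" "V \<subseteq> W" "E \<subseteq> F"
    using LeastI_ex[OF ex_ktree_supergraph[OF assms]] unfolding treewidth_def by blast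
  \<comment> \<open>Connectedness refers to the \<open>k\<close>-tree \<open>F\<close>, where the
    hitting set is found; sets connected in \<open>E\<close> are also connected in
    \<open>F\<close>.\<close>
  define \<B> where "\<B> = {U. U \<subseteq> V \<and> connected_in F U \<and> card V < 2 * card U}"
  have "A \<inter> B \<noteq> {}" if "A \<in> \<B>" "B \<in> \<B>" for A B
  proof
    assume "A \<inter> B = {}"
    moreover have "finite A" "finite B"
      using that V finite_subset by (auto simp: \<B>_def)
    ultimately have "card A + card B = card (A \<union> B)"
      by (simp add: card_Un_disjoint)
    also have "\<dots> \<le> card V"
      using that V by (intro card_mono) (auto simp: \<B>_def)
    finally show False using that by (auto simp: \<B>_def)
  qed
  then have "touching F A B" if "A \<in> \<B>" "B \<in> \<B>" for A B
    using that unfolding touching_def by blast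
  then obtain S where S: "S \<subseteq> W" "card S \<le> treewidth V E + 1" "\<forall>B\<in>\<B>. B \<inter> S \<noteq> {}"
    using ktree_bramble_hitting_set[OF W(1), of \<B>] W(2) unfolding \<B>_def by blast
  \<comment> \<open>The \<open>k\<close>-tree may have vertices outside \<open>V\<close>, so the
    hitting set is cut down to \<open>V\<close>.\<close>
  have "card (S \<inter> V) \<le> card S"
    using S(1) ktree_finite[OF W(1)] finite_subset by (intro card_mono) auto
  moreover have "2 * card U \<le> card V" if "U \<subseteq> V - S \<inter> V" "connected_in E U" for U
  proof (rule ccontr)
    assume "\<not> ?thesis"
    then have "U \<in> \<B>"
      using that connected_in_mono[OF _ W(3)] by (auto simp: \<B>_def)
    then show False using S(3) that by blast
  qed
  ultimately show ?thesis
    using S(2) by (intro exI[of _ "S \<inter> V"]) auto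
qed

text \<open>Take a largest \<open>A\<close> among the sets of size at most \<open>L\<close> that are unions of components. Its
  complement is too large to be connected, and maximality makes both sides of any splitting of
  the complement small.\<close>

lemma balanced_partition:
  fixes L :: real
  assumes fin: "finite V" and L: "0 \<le> L"
    and conn: "\<And>U. U \<subseteq> V \<Longrightarrow> connected_in E U \<Longrightarrow> card U < card V - L"
  shows "(\<exists>A\<subseteq>V. L \<le> card A \<and> card A \<le> card V - L \<and> (\<forall>a\<in>A. \<forall>b\<in>V-A. {a,b} \<notin> E)) \<or>
    (\<exists>A B C. A \<union> B \<union> C = V \<and> A \<inter> B = {} \<and> A \<inter> C = {} \<and> B \<inter> C = {} \<and>
       card A \<le> L \<and> card B \<le> L \<and> card C \<le> L \<and>
       (\<forall>a\<in>A. \<forall>b\<in>B. {a,b} \<notin> E) \<and> (\<forall>a\<in>A. \<forall>c\<in>C. {a,c} \<notin> E) \<and> (\<forall>b\<in>B. \<forall>c\<in>C. {b,c} \<notin> E))"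
proof (cases "\<exists>A\<subseteq>V. L \<le> card A \<and> card A \<le> card V - L \<and> (\<forall>a\<in>A. \<forall>b\<in>V-A. {a,b} \<notin> E)")
  case False
  \<comment> \<open>\<open>clo\<close> describes the unions of components.\<close>
  define clo where "clo A \<longleftrightarrow> A \<subseteq> V \<and> (\<forall>a\<in>A. \<forall>b\<in>V-A. {a,b} \<notin> E)" for A
  \<comment> \<open>Failure of the first alternative means that no union of components has a size
    between \<open>L\<close> and \<open>card V - L\<close>.\<close>
  have gap: "card A < L \<or> card A > card V - L" if "clo A" for A
    using False that unfolding clo_def by (meson not_less)
  have compl: "real (card (V - A)) = real (card V) - real (card A)" if "clo A" for A
    using that fin unfolding clo_def by (metis card_Diff_subset card_mono finite_subset of_nat_diff)
  have "clo {} \<and> card ({}::'a set) \<le> L"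
    using L by (simp add: clo_def)
  moreover have "\<forall>A. clo A \<and> card A \<le> L \<longrightarrow> card A < Suc (card V)"
    using card_mono[OF fin] by (auto simp: clo_def less_Suc_eq_le)
  ultimately obtain A where A: "clo A" "card A \<le> L"
    and max: "\<And>B. clo B \<Longrightarrow> card B \<le> L \<Longrightarrow> card B \<le> card A"
    using ex_has_greatest_nat[of "\<lambda>A. clo A \<and> card A \<le> L" "{}" card "Suc (card V)"]
    by (metis less_imp_le)
  have AV: "A \<subseteq> V" using A(1) by (simp add: clo_def)
  have "\<not> connected_in E (V - A)"
    using conn[of "V - A"] compl[OF A(1)] A(2) by auto
  then consider "V - A = {}" | B where "B \<subseteq> V - A" "B \<noteq> {}" "B \<noteq> V - A"
      "\<And>b c. b \<in> B \<Longrightarrow> c \<in> V - A - B \<Longrightarrow> {b,c} \<notin> E"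
    unfolding connected_in_def by blast
  then show ?thesis
  proof cases
    case 1
    then have "A = V" using AV by blast
    then show ?thesis
      using A(2) L by (intro disjI2 exI[of _ A] exI[of _ "{}"]) auto
  next
    case 2
    define C where "C = V - A - B"
    have part: "A \<union> B \<union> C = V" "A \<inter> B = {}" "A \<inter> C = {}" "B \<inter> C = {}" "B \<noteq> {}" "C \<noteq> {}"
      using 2 AV unfolding C_def by blast+
    have noA: "\<And>a b. a \<in> A \<Longrightarrow> b \<in> B \<union> C \<Longrightarrow> {a,b} \<notin> E"
      using A(1) part unfolding clo_def by blast
    have noB: "\<And>b c. b \<in> B \<Longrightarrow> c \<in> C \<Longrightarrow> {b,c} \<notin> E"
      using 2 unfolding C_def by blast
    have noC: "\<And>c b. c \<in> C \<Longrightarrow> b \<in> B \<Longrightarrow> {c,b} \<notin> E"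
      using noB by (metis insert_commute)
    have fins: "finite A" "finite B" "finite C"
      using fin part by (auto intro: finite_subset)
    have cAB: "clo (A \<union> B)" and cAC: "clo (A \<union> C)"
      unfolding clo_def using noA noB noC part by auto
    \<comment> \<open>Both unions are closed and larger than the maximal \<open>A\<close>, so they
      exceed \<open>L\<close> and, by \<open>gap\<close>, even \<open>card V - L\<close>. Their
      complements \<open>C\<close> and \<open>B\<close> are therefore small.\<close>
    have "card (A \<union> B) > card A" "card (A \<union> C) > card A"
      using part fins by (auto simp: card_Un_disjoint card_gt_0_iff)
    then have "\<not> card (A \<union> B) \<le> L" "\<not> card (A \<union> C) \<le> L"
      using max cAB cAC by (auto simp: not_le[symmetric])
    then have "card (A \<union> B) > card V - L" "card (A \<union> C) > card V - L"
      using gap[OF cAB] gap[OF cAC] by auto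
    moreover have "V - (A \<union> B) = C" "V - (A \<union> C) = B"
      using part by blast+
    then have "real (card C) = real (card V) - real (card (A \<union> B))"
        "real (card B) = real (card V) - real (card (A \<union> C))"
      using compl[OF cAB] compl[OF cAC] by auto
    ultimately have "card B \<le> L" "card C \<le> L" by linarith+
    then show ?thesis
      using part noA noB A(2) by (intro disjI2 exI[of _ A] exI[of _ B] exI[of _ C]) auto
  qed
qed auto

section \<open>Cross edges of a vertex labelling\<close>

text \<open>Encoding a splitting by labels treats two and three parts uniformly and lets splittings
  be counted as functions.\<close>

definition cross :: "'a set \<Rightarrow> ('a \<Rightarrow> nat) \<Rightarrow> 'a set set" where
  "cross U f = {e. \<exists>u\<in>U. \<exists>v\<in>U. f u \<noteq> f v \<and> e = {u,v}}"

lemma mem_crossI: "u \<in> U \<Longrightarrow> v \<in> U \<Longrightarrow> f u \<noteq> f v \<Longrightarrow> {u, v} \<in> cross U f"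
  unfolding cross_def by blast

lemma cross_subset: "U \<subseteq> V \<Longrightarrow> cross U f \<subseteq> [V]\<^bsup>2\<^esup>"
  by (auto simp: cross_def nsets_def card_insert_if)

lemma card_bipartite:
  assumes "A \<inter> B = {}"
  shows "card ((\<lambda>(a,b). {a,b}) ` (A \<times> B)) = card A * card B"
proof -
  have "inj_on (\<lambda>(a,b). {a,b}) (A \<times> B)"
    using assms by (auto simp: inj_on_def doubleton_eq_iff)
  then show ?thesis by (simp add: card_image card_cartesian_product)
qed

lemma card_cross_two:
  assumes "finite U" "A \<union> B = U" "A \<inter> B = {}" "\<And>a. a \<in> A \<Longrightarrow> f a = 0" "\<And>b. b \<in> B \<Longrightarrow> f b = 1"
  shows "card A * card B \<le> card (cross U f)"
proof -
  have "(\<lambda>(a,b). {a,b}) ` (A \<times> B) \<subseteq> cross U f"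
    unfolding assms(2)[symmetric] by (auto intro!: mem_crossI simp: assms(4,5))
  moreover have "finite (cross U f)"
    using cross_subset[of U U f] finite_imp_finite_nsets[OF assms(1)] finite_subset by blast
  ultimately show ?thesis
    using card_mono card_bipartite[OF assms(3)] by metis
qed

lemma card_cross_three:
  assumes "finite U" "A \<union> B \<union> C = U" "A \<inter> B = {}" "A \<inter> C = {}" "B \<inter> C = {}"
    "\<And>a. a \<in> A \<Longrightarrow> f a = 0" "\<And>b. b \<in> B \<Longrightarrow> f b = 1" "\<And>c. c \<in> C \<Longrightarrow> f c = 2"
  shows "card A * card B + card A * card C + card B * card C \<le> card (cross U f)"
proof -
  let ?p = "\<lambda>(a,b). {a,b}"
  have fins: "finite A" "finite B" "finite C"
    using assms by (auto intro: finite_subset)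
  have "?p ` (A \<times> (B \<union> C)) \<union> ?p ` (B \<times> C) \<subseteq> cross U f"
    unfolding assms(2)[symmetric] by (auto intro!: mem_crossI simp: assms(6-8))
  moreover have "finite (cross U f)"
    using cross_subset[of U U f] finite_imp_finite_nsets[OF assms(1)] finite_subset by blast
  moreover have "?p ` (A \<times> (B \<union> C)) \<inter> ?p ` (B \<times> C) = {}"
    using assms(3-5) by (auto simp: doubleton_eq_iff)
  then have "card (?p ` (A \<times> (B \<union> C)) \<union> ?p ` (B \<times> C)) = card A * card (B \<union> C) + card B * card C"
    using card_bipartite[of A "B \<union> C"] card_bipartite[of B C] assms(3-5) fins
    by (subst card_Un_disjoint) (auto simp: Int_Un_distrib)
  ultimately show ?thesis
    using card_mono[of "cross U f"] assms(5) fins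
    by (metis (no_types, lifting) add_mult_distrib2 card_Un_disjoint)
qed

section \<open>Extremal part sizes\<close>

text \<open>The difference of the two sides is exactly
  \<open>(a - \<alpha> * n) * (n - \<alpha> * n - a)\<close>.\<close>

lemma product_ge_of_balanced:
  fixes a n \<alpha> :: real
  assumes "\<alpha> * n \<le> a" "a \<le> n - \<alpha> * n"
  shows "\<alpha> * (1 - \<alpha>) * n\<^sup>2 \<le> a * (n - a)"
proof -
  have "0 \<le> (a - \<alpha> * n) * (n - \<alpha> * n - a)" using assms by simp
  then show ?thesis by (simp add: algebra_simps power2_eq_square)
qed

text \<open>The difference of the two sides is the sum of pairwise products of the deficits
  \<open>\<alpha> * n - a\<close>, \<open>\<alpha> * n - b\<close>, \<open>\<alpha> * n - c\<close>.
  Equality holds when two parts have the full size \<open>\<alpha> * n\<close>.\<close>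

lemma pairwise_products_ge:
  fixes a b c n \<alpha> :: real
  assumes "a \<le> \<alpha> * n" "b \<le> \<alpha> * n" "c \<le> \<alpha> * n" "a + b + c = n"
  shows "(2 * \<alpha> - 3 * \<alpha>\<^sup>2) * n\<^sup>2 \<le> a * b + a * c + b * c"
proof -
  define x y z where "x = \<alpha> * n - a" and "y = \<alpha> * n - b" and "z = \<alpha> * n - c"
  have "0 \<le> x * y + x * z + y * z"
    using assms by (simp add: x_def y_def z_def)
  moreover have "x * y + x * z + y * z = 3 * (\<alpha> * n)\<^sup>2 - 2 * (\<alpha> * n) * (a + b + c) + (a * b + a * c + b * c)"
    by (simp add: x_def y_def z_def algebra_simps power2_eq_square)
  ultimately have "0 \<le> 3 * (\<alpha> * n)\<^sup>2 - 2 * (\<alpha> * n) * n + (a * b + a * c + b * c)"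
    using assms(4) by simp
  then show ?thesis by (simp add: algebra_simps power2_eq_square)
qed

section \<open>The union bound\<close>

text \<open>With denominators cleared, this says that drawing \<open>m\<close> elements without
  replacement stays inside an \<open>M\<close>-subset at most as likely as drawing with replacement,
  because \<open>(M - i) / (N - i) \<le> M / N\<close> at each draw.\<close>

lemma binomial_ratio_le:
  assumes "M \<le> N"
  shows "(M choose m) * N ^ m \<le> (N choose m) * M ^ m"
proof (induction m)
  case (Suc m)
  have absorb: "Suc m * (X choose Suc m) = (X choose m) * (X - m)" for X
    using binomial_absorb_comp[of X m] binomial_absorption[of m X] by (metis mult.commute)
  have step: "(M - m) * N \<le> (N - m) * M"
  proof (cases "m \<le> M")
    case True
    then have "M * N - m * N \<le> M * N - m * M"
      using assms by (intro diff_le_mono2 mult_le_mono2)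
    then show ?thesis by (simp add: diff_mult_distrib diff_mult_distrib2 mult.commute)
  qed simp
  have "Suc m * ((M choose Suc m) * N ^ Suc m) = (M choose m) * (M - m) * N ^ Suc m"
    by (simp only: absorb mult.assoc[symmetric])
  also have "\<dots> = ((M choose m) * N ^ m) * ((M - m) * N)"
    by (simp add: mult_ac)
  also have "\<dots> \<le> ((N choose m) * M ^ m) * ((N - m) * M)"
    by (intro mult_le_mono Suc step)
  also have "\<dots> = (N choose m) * (N - m) * M ^ Suc m"
    by (simp add: mult_ac)
  also have "\<dots> = Suc m * ((N choose Suc m) * M ^ Suc m)"
    by (simp only: absorb mult.assoc[symmetric])
  finally show ?case by (simp only: mult_le_cancel1)
qed simp

text \<open>As \<open>n choose 2\<close> is at most half of \<open>n ^ 2\<close>, the set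
  \<open>C\<close> contains at least a fraction \<open>2 * x\<close> of all pairs.\<close>

lemma prob_erdos_renyi_avoids_le:
  fixes x :: real
  assumes m: "m \<le> n choose 2" and C: "C \<subseteq> [{..<n}]\<^bsup>2\<^esup>"
    and x: "x * real n ^ 2 \<le> card C" "0 < n choose 2" and x0: "0 \<le> x"
  shows "measure_pmf.prob (erdos_renyi n m) {E. E \<inter> C = {}} \<le> (1 - 2 * x) ^ m"
proof -
  let ?P = "[{..<n}]\<^bsup>2\<^esup>" and ?N = "n choose 2"
  define X where "X = {E. E \<subseteq> ?P \<and> card E = m}"
  have finP: "finite ?P" by (rule finite_imp_finite_nsets) simp
  have cardP: "card ?P = ?N" by (simp add: card_nsets)
  have cX: "card X = ?N choose m"
    unfolding X_def using n_subsets[OF finP, of m] cardP by simp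
  then have "card X > 0" using m by simp
  then have X: "finite X" "X \<noteq> {}" by (auto simp: card_gt_0_iff)
  have CN: "card C \<le> ?N"
    using card_mono[OF finP C] cardP by simp
  have "X \<inter> {E. E \<inter> C = {}} = {E. E \<subseteq> ?P - C \<and> card E = m}"
    by (auto simp: X_def)
  then have "card (X \<inter> {E. E \<inter> C = {}}) = (?N - card C) choose m"
    using n_subsets[of "?P - C" m] finP C cardP by (simp add: card_Diff_subset finite_subset)
  then have "measure_pmf.prob (erdos_renyi n m) {E. E \<inter> C = {}} =
      real ((?N - card C) choose m) / real (?N choose m)"
    unfolding erdos_renyi_def X_def[symmetric] using measure_pmf_of_set[OF X(2,1)] cX by simp
  also have "\<dots> \<le> (real (?N - card C) / real ?N) ^ m"
  proof -
    have "real ((?N - card C) choose m) * real ?N ^ m \<le> real (?N choose m) * real (?N - card C) ^ m"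
      using binomial_ratio_le[of "?N - card C" ?N m]
      by (metis diff_le_self of_nat_le_iff of_nat_mult of_nat_power)
    then show ?thesis
      using x(2) m by (simp add: power_divide divide_simps mult.commute)
  qed
  also have "\<dots> \<le> (1 - 2 * x) ^ m"
  proof (rule power_mono)
    have "2 * ?N \<le> n * (n - 1)" by (simp add: choose_two)
    also have "\<dots> \<le> n ^ 2" by (simp add: power2_eq_square)
    finally have "2 * real ?N \<le> real n ^ 2"
      by (metis of_nat_le_iff of_nat_mult of_nat_numeral of_nat_power)
    then have "2 * x * real ?N \<le> x * real n ^ 2"
      using mult_left_mono[OF _ x0] by fastforce
    then have "2 * x * real ?N \<le> card C" using x(1) by linarith
    then show "real (?N - card C) / real ?N \<le> 1 - 2 * x"
      using x(2) CN by (simp add: field_simps of_nat_diff)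
  qed simp
  finally show ?thesis .
qed

text \<open>Weight every subset \<open>S\<close> of \<open>V\<close> by \<open>l ^ card S\<close>; the total weight is \<open>(1 + l) ^ card V\<close>.\<close>

lemma card_small_subsets_le:
  fixes l :: real
  assumes V: "finite V" and l: "0 < l" "l \<le> 1"
  shows "card {S. S \<subseteq> V \<and> card S \<le> s} \<le> (1 + l) ^ card V / l ^ s"
proof -
  let ?I = "{S. S \<subseteq> V \<and> card S \<le> s}"
  have "card ?I * l ^ s = (\<Sum>S\<in>?I. l ^ s)" by simp
  also have "\<dots> \<le> (\<Sum>S\<in>?I. l ^ card S)"
    using l by (intro sum_mono power_decreasing) auto
  also have "\<dots> \<le> (\<Sum>S\<in>Pow V. l ^ card S)"
    using V l by (intro sum_mono2) auto
  also have "\<dots> = (1 + l) ^ card V"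
    using prod_add[OF V, of "\<lambda>_. l" "\<lambda>_. 1"]
    by (simp add: add.commute)
  finally show ?thesis using l by (simp add: field_simps)
qed

text \<open>Labels are given to all of \<open>{..<n}\<close>, including \<open>S\<close>, so that
  the labellings to be counted do not depend on \<open>S\<close>. For the same reason
  \<open>x\<close> is relative to \<open>n ^ 2\<close> and not to the remaining vertices.\<close>

definition split_event :: "nat \<Rightarrow> nat \<Rightarrow> nat \<Rightarrow> real \<Rightarrow> nat set set set" where
  "split_event n s r x = {E. \<exists>S\<subseteq>{..<n}. card S \<le> s \<and> (\<exists>f\<in>{..<n} \<rightarrow>\<^sub>E {..<r}.
      x * real n ^ 2 \<le> card (cross ({..<n} - S) f) \<and> E \<inter> cross ({..<n} - S) f = {})}"

text \<open>A union bound over pairs of a removed set and a labelling; the weight \<open>l\<close>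
  stays free so that it can be balanced against \<open>s\<close> later.\<close>

lemma prob_split_event_le:
  fixes x l :: real
  assumes m: "m \<le> n choose 2" "0 < n choose 2" and x: "0 \<le> x" "2 * x \<le> 1" and l: "0 < l" "l \<le> 1"
  shows "measure_pmf.prob (erdos_renyi n m) (split_event n s r x)
    \<le> (1 + l) ^ n / l ^ s * (real r ^ n * (1 - 2 * x) ^ m)"
proof -
  let ?S = "{S. S \<subseteq> {..<n} \<and> card S \<le> s}" and ?F = "{..<n} \<rightarrow>\<^sub>E {..<r}"
  define I where "I = {(S, f). (S, f) \<in> ?S \<times> ?F \<and> x * real n ^ 2 \<le> card (cross ({..<n} - S) f)}"
  let ?Ev = "\<lambda>(S, f). {E. E \<inter> cross ({..<n} - S) f = {}}"
  have finSF: "finite (?S \<times> ?F)"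
    by (intro finite_cartesian_product finite_PiE) auto
  have IS: "I \<subseteq> ?S \<times> ?F" by (auto simp: I_def)
  then have finI: "finite I" using finSF finite_subset by blast
  have "split_event n s r x = (\<Union>i\<in>I. ?Ev i)"
    unfolding split_event_def I_def by auto
  then have "measure_pmf.prob (erdos_renyi n m) (split_event n s r x) \<le>
      (\<Sum>i\<in>I. measure_pmf.prob (erdos_renyi n m) (?Ev i))"
    using measure_pmf.finite_measure_subadditive_finite[OF finI, of ?Ev] by simp
  also have "\<dots> \<le> (\<Sum>i\<in>I. (1 - 2 * x) ^ m)"
  proof (rule sum_mono)
    fix i assume i: "i \<in> I"
    obtain S f where "i = (S, f)" by fastforce
    then show "measure_pmf.prob (erdos_renyi n m) (?Ev i) \<le> (1 - 2 * x) ^ m"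
      using i m x prob_erdos_renyi_avoids_le[of m n "cross ({..<n} - S) f" x]
        cross_subset[of "{..<n} - S" "{..<n}" f]
      by (auto simp: I_def)
  qed
  also have "\<dots> = card I * (1 - 2 * x) ^ m" by simp
  also have "\<dots> \<le> (card ?S * real r ^ n) * (1 - 2 * x) ^ m"
  proof (rule mult_right_mono)
    have "card I \<le> card (?S \<times> ?F)" by (rule card_mono[OF finSF IS])
    also have "\<dots> = card ?S * r ^ n"
      by (simp add: card_cartesian_product card_PiE)
    finally show "real (card I) \<le> card ?S * real r ^ n"
      by (metis of_nat_le_iff of_nat_mult of_nat_power)
  qed (use x in simp)
  also have "\<dots> \<le> ((1 + l) ^ n / l ^ s * real r ^ n) * (1 - 2 * x) ^ m"
    using card_small_subsets_le[OF _ l, of "{..<n}" s] x by (intro mult_right_mono) auto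
  finally show ?thesis by (simp add: mult.assoc)
qed

section \<open>From small treewidth to a splitting\<close>

lemma small_treewidth_split:
  assumes E: "E \<subseteq> [{..<n}]\<^bsup>2\<^esup>" and tw: "treewidth {..<n} E + 1 \<le> s" and s: "real s \<le> 3 / 10000 * n"
    and n: "0 < n"
  shows "E \<in> split_event n s 2 (239 / 1000) \<union> split_event n s 3 (3213 / 10000)"
proof -
  obtain S where S: "S \<subseteq> {..<n}" "card S \<le> treewidth {..<n} E + 1"
    and sep: "\<And>U. U \<subseteq> {..<n} - S \<Longrightarrow> connected_in E U \<Longrightarrow> 2 * card U \<le> n"
    using treewidth_separator[OF _ E] by auto
  have Ss: "card S \<le> s" using S(2) tw by simp
  define V where "V = {..<n} - S"
  have finV: "finite V" by (simp add: V_def)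
  have "card V = n - card S"
    using S(1) by (simp add: V_def card_Diff_subset finite_subset)
  moreover have "card S \<le> n" using card_mono[OF _ S(1)] by simp
  ultimately have "real (card V) = real n - card S" by (simp add: of_nat_diff)
  then have cV: "9997 / 10000 * n \<le> card V"
    using Ss s by linarith
  \<comment> \<open>Removing \<open>S\<close> costs little: \<open>0.9997 ^ 2\<close> exceeds
    \<open>0.9994\<close>.\<close>
  have cV2: "9994 / 10000 * real n ^ 2 \<le> real (card V) ^ 2"
  proof -
    have "(9997 / 10000 * real n) ^ 2 \<le> real (card V) ^ 2"
      by (rule power_mono[OF cV]) simp
    moreover have "9994 / 10000 * real n ^ 2 \<le> (9997 / 10000)\<^sup>2 * real n ^ 2"
      by (intro mult_right_mono) (simp_all add: power2_eq_square)
    ultimately show ?thesis by (simp only: power_mult_distrib)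
  qed
  define L where "L = 396 / 1000 * real (card V)"
  \<comment> \<open>A connected set has at most \<open>n / 2\<close> vertices, whereas
    \<open>card V - L\<close> is at least \<open>0.604 * 0.9997 * n\<close>.\<close>
  have "card U < card V - L" if "U \<subseteq> V" "connected_in E U" for U
  proof -
    have "2 * card U \<le> n" using sep that by (simp add: V_def)
    then have "2 * real (card U) \<le> n" by linarith
    then show ?thesis using cV n by (simp add: L_def)
  qed
  then consider
      (two) A where "A \<subseteq> V" "L \<le> card A" "card A \<le> card V - L" "\<forall>a\<in>A. \<forall>b\<in>V-A. {a,b} \<notin> E"
    | (three) A B C where "A \<union> B \<union> C = V" "A \<inter> B = {}" "A \<inter> C = {}" "B \<inter> C = {}"
      "card A \<le> L" "card B \<le> L" "card C \<le> L"
      "\<forall>a\<in>A. \<forall>b\<in>B. {a,b} \<notin> E" "\<forall>a\<in>A. \<forall>c\<in>C. {a,c} \<notin> E" "\<forall>b\<in>B. \<forall>c\<in>C. {b,c} \<notin> E"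
    using balanced_partition[OF finV, of L E] unfolding L_def by auto
  then show ?thesis
  proof cases
    case two
    define f where "f = restrict (\<lambda>v. if v \<in> A then 0 else 1 :: nat) {..<n}"
    have AV: "a \<in> V \<Longrightarrow> a < n" for a by (simp add: V_def)
    have "real (card (V - A)) = real (card V) - real (card A)"
      using two(1) finV card_mono[OF finV two(1)] by (simp add: card_Diff_subset finite_subset of_nat_diff)
    then have "0.396 * (1 - 0.396) * real (card V) ^ 2 \<le> real (card A * card (V - A))"
      using product_ge_of_balanced[of "0.396" "card V" "card A"] two(2,3) by (simp add: L_def)
    also have "\<dots> \<le> card (cross V f)"
    proof -
      have "card A * card (V - A) \<le> card (cross V f)"
      proof (rule card_cross_two[OF finV])
        show "a \<in> A \<Longrightarrow> f a = 0" "a \<in> V - A \<Longrightarrow> f a = 1" for a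
          using AV[of a] two(1) by (auto simp: f_def)
      qed (use two(1) in auto)
      then show ?thesis by linarith
    qed
    \<comment> \<open>\<open>0.396 * 0.604 * 0.9994\<close> is slightly above
      \<open>0.239\<close>.\<close>
    finally have "239 / 1000 * real n ^ 2 \<le> card (cross V f)"
      using cV2 by simp
    moreover have "E \<inter> cross V f = {}"
    proof -
      have "{u,v} \<notin> E" if "u \<in> V" "v \<in> V" "f u \<noteq> f v" for u v
      proof -
        have "u \<in> A \<and> v \<in> V - A \<or> v \<in> A \<and> u \<in> V - A"
          using that AV[of u] AV[of v] by (auto simp: f_def split: if_splits)
        then show ?thesis using two(4) by (metis insert_commute)
      qed
      then show ?thesis by (auto simp: cross_def)
    qed
    moreover have "f \<in> {..<n} \<rightarrow>\<^sub>E {..<2}"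
      by (auto simp: f_def)
    ultimately have "E \<in> split_event n s 2 (239 / 1000)"
      using S(1) Ss unfolding split_event_def V_def by blast
    then show ?thesis by blast
  next
    case three
    define f where "f = restrict (\<lambda>v. if v \<in> A then 0 else if v \<in> B then 1 else 2 :: nat) {..<n}"
    have AV: "a \<in> V \<Longrightarrow> a < n" for a by (simp add: V_def)
    have fins: "finite A" "finite B" "finite C"
      using finV three(1) by (auto intro: finite_subset)
    have "card V = card A + card B + card C"
      using three(1-4) fins by (auto simp: card_Un_disjoint Int_Un_distrib2)
    then have sum: "real (card A) + real (card B) + real (card C) = real (card V)" by simp
    have "(2 * (396/1000) - 3 * (396/1000)\<^sup>2) * real (card V) ^ 2
        \<le> real (card A) * real (card B) + real (card A) * real (card C) + real (card B) * real (card C)"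
      using three(5-7) sum unfolding L_def by (rule pairwise_products_ge)
    also have "\<dots> = real (card A * card B + card A * card C + card B * card C)"
      by simp
    also have "\<dots> \<le> card (cross V f)"
    proof -
      have "card A * card B + card A * card C + card B * card C \<le> card (cross V f)"
      proof (rule card_cross_three[OF finV three(1-4)])
        show "a \<in> A \<Longrightarrow> f a = 0" "a \<in> B \<Longrightarrow> f a = 1" "a \<in> C \<Longrightarrow> f a = 2" for a
          using AV[of a] three(1-4) by (auto simp: f_def)
      qed
      then show ?thesis by linarith
    qed
    \<comment> \<open>\<open>2 * 0.396 - 3 * 0.396 ^ 2\<close> is \<open>0.321552\<close>, and times
      \<open>0.9994\<close> it still exceeds \<open>0.3213\<close>.\<close>
    finally have "3213 / 10000 * real n ^ 2 \<le> card (cross V f)"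
      using cV2 by (simp add: power2_eq_square)
    moreover have "E \<inter> cross V f = {}"
    proof -
      have "{u,v} \<notin> E" if "u \<in> V" "v \<in> V" "f u \<noteq> f v" for u v
      proof -
        have "u < n" "v < n" using that AV by auto
        moreover have "u \<in> A \<union> B \<union> C" "v \<in> A \<union> B \<union> C" using that three(1) by auto
        ultimately show ?thesis
          using that(3) three(8-10) by (auto simp: f_def insert_commute split: if_splits)
      qed
      then show ?thesis by (auto simp: cross_def)
    qed
    moreover have "f \<in> {..<n} \<rightarrow>\<^sub>E {..<3}"
      by (auto simp: f_def)
    ultimately have "E \<in> split_event n s 3 (3213 / 10000)"
      using S(1) Ss unfolding split_event_def V_def by blast
    then show ?thesis by blast
  qed
qed

section \<open>Numerical estimates\<close>

text \<open>Taking 14th powers turns the edge ratio \<open>15/14\<close> into integer exponents, so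
  that only one numerical inequality remains.\<close>

lemma exponential_decay:
  fixes r q :: real
  assumes rq: "0 \<le> r" "0 \<le> q" "q \<le> 1" and num: "r ^ 14 * q ^ 15 \<le> 0.96" and m: "15 * n \<le> 14 * m"
  shows "r ^ n * q ^ m \<le> 0.998 ^ n"
proof -
  have "(r ^ n * q ^ m) ^ 14 = (r ^ 14) ^ n * q ^ (14 * m)"
    by (simp add: power_mult_distrib flip: power_mult) (simp add: mult.commute)
  also have "\<dots> \<le> (r ^ 14) ^ n * q ^ (15 * n)"
    using rq m by (intro mult_left_mono power_decreasing) auto
  also have "\<dots> = (r ^ 14 * q ^ 15) ^ n"
    by (simp add: power_mult_distrib power_mult)
  also have "\<dots> \<le> (0.998 ^ 14) ^ n"
  proof (rule power_mono)
    have "(0.96 :: real) \<le> 0.998 ^ 14" by (simp add: power_divide)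
    then show "r ^ 14 * q ^ 15 \<le> 0.998 ^ 14" using num by (rule order_trans[rotated])
  qed (use rq in simp)
  also have "\<dots> = (0.998 ^ n) ^ 14"
    by (simp add: mult.commute flip: power_mult)
  finally show ?thesis
    by (rule power_le_imp_le_base[of _ 13, simplified]) simp
qed

text \<open>This pays for the factor \<open>1 / l ^ k\<close> with \<open>l = 1/2000\<close>. By
  Bernoulli, \<open>1.0004 ^ 2500\<close> is at least 2, hence \<open>1.0004 ^ 100000\<close> is at
  least \<open>2 ^ 40\<close>.\<close>

lemma separator_count_le:
  assumes "100000 * k \<le> n"
  shows "(2000 :: real) ^ k \<le> 1.0004 ^ n"
proof -
  define d :: real where "d = 1.0004"
  have d: "1 \<le> d" by (simp add: d_def)
  have "2 \<le> d ^ 2500"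
  proof -
    have "1 + real 2500 * (d - 1) \<le> (1 + (d - 1)) ^ 2500"
      using d by (intro Bernoulli_inequality) simp
    moreover have "1 + real 2500 * (d - 1) = 2" by (simp add: d_def)
    moreover have "1 + (d - 1) = d" by simp
    ultimately show ?thesis by (simp only:)
  qed
  then have "2 ^ 40 \<le> (d ^ 2500) ^ 40"
    by (rule power_mono) simp
  moreover have "(d ^ 2500) ^ 40 = d ^ 100000"
    by (simp flip: power_mult)
  ultimately have "2000 \<le> d ^ 100000"
    by simp
  then have "2000 ^ k \<le> (d ^ 100000) ^ k" by (rule power_mono) simp
  also have "\<dots> = d ^ (100000 * k)" by (simp only: power_mult)
  also have "\<dots> \<le> d ^ n" using assms d by (rule power_increasing)
  finally show ?thesis by (simp only: d_def)
qed

lemma prob_small_treewidth_le: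
  assumes n: "10000 \<le> n" and m: "15 * n \<le> 14 * m" "m \<le> n choose 2"
  shows "measure_pmf.prob (erdos_renyi n m) {E. real (treewidth {..<n} E) \<le> 1 / 100000 * n}
    \<le> 4000 * 0.999 ^ n"
proof -
  let ?M = "erdos_renyi n m"
  define k where "k = n div 100000"
  have k: "100000 * k \<le> n" by (simp add: k_def)
  have pos: "0 < n choose 2" using n by simp
  have fP: "finite ([{..<n}]\<^bsup>2\<^esup>)" by (rule finite_imp_finite_nsets) simp
  have "card {E. E \<subseteq> [{..<n}]\<^bsup>2\<^esup> \<and> card E = m} = (n choose 2) choose m"
    using n_subsets[OF fP, of m] by (simp add: card_nsets)
  then have "card {E. E \<subseteq> [{..<n}]\<^bsup>2\<^esup> \<and> card E = m} > 0"
    using m(2) by simp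
  then have "set_pmf ?M = {E. E \<subseteq> [{..<n}]\<^bsup>2\<^esup> \<and> card E = m}"
    unfolding erdos_renyi_def by (intro set_pmf_of_set) (auto simp: card_gt_0_iff)
  then have supp: "E \<subseteq> [{..<n}]\<^bsup>2\<^esup>" if "E \<in> set_pmf ?M" for E
    using that by auto
  have "E \<in> split_event n (k+1) 2 (239/1000) \<union> split_event n (k+1) 3 (3213/10000)"
    if "E \<in> set_pmf ?M" "real (treewidth {..<n} E) \<le> 1 / 100000 * n" for E
  proof (rule small_treewidth_split)
    have "100000 * treewidth {..<n} E \<le> n"
      using that(2) by linarith
    then show "treewidth {..<n} E + 1 \<le> k + 1"
      by (simp add: k_def less_eq_div_iff_mult_less_eq mult.commute)
    \<comment> \<open>Since \<open>10000 \<le> n\<close>, the extra 1 is at most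
      \<open>n / 10000\<close>.\<close>
    show "real (k + 1) \<le> 3 / 10000 * n"
      using k n by linarith
  qed (use that supp n in auto)
  then have "measure_pmf.prob ?M {E. real (treewidth {..<n} E) \<le> 1 / 100000 * n} \<le>
      measure_pmf.prob ?M (split_event n (k+1) 2 (239/1000) \<union> split_event n (k+1) 3 (3213/10000))"
    by (intro measure_pmf.finite_measure_mono_AE) (auto simp: AE_measure_pmf_iff)
  also have "\<dots> \<le> measure_pmf.prob ?M (split_event n (k+1) 2 (239/1000)) +
      measure_pmf.prob ?M (split_event n (k+1) 3 (3213/10000))"
    by (rule measure_Un_le) auto
  also have "\<dots> \<le> (1 + 1/2000) ^ n / (1/2000) ^ (k+1) * 0.998 ^ n +
      (1 + 1/2000) ^ n / (1/2000) ^ (k+1) * 0.998 ^ n"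
  proof (rule add_mono)
    show "measure_pmf.prob ?M (split_event n (k+1) 2 (239/1000)) \<le>
        (1 + 1/2000) ^ n / (1/2000) ^ (k+1) * 0.998 ^ n"
    proof (rule order_trans[OF prob_split_event_le[OF m(2) pos, where l = "1/2000"]])
      show "(1 + 1/2000) ^ n / (1/2000) ^ (k+1) * (real 2 ^ n * (1 - 2 * (239/1000)) ^ m)
          \<le> (1 + 1/2000 :: real) ^ n / (1/2000) ^ (k+1) * 0.998 ^ n"
        by (intro mult_left_mono exponential_decay[OF _ _ _ _ m(1)]) (simp_all add: power_divide)
    qed simp_all
    show "measure_pmf.prob ?M (split_event n (k+1) 3 (3213/10000)) \<le>
        (1 + 1/2000) ^ n / (1/2000) ^ (k+1) * 0.998 ^ n"
    proof (rule order_trans[OF prob_split_event_le[OF m(2) pos, where l = "1/2000"]])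
      show "(1 + 1/2000) ^ n / (1/2000) ^ (k+1) * (real 3 ^ n * (1 - 2 * (3213/10000)) ^ m)
          \<le> (1 + 1/2000 :: real) ^ n / (1/2000) ^ (k+1) * 0.998 ^ n"
        by (intro mult_left_mono exponential_decay[OF _ _ _ _ m(1)]) (simp_all add: power_divide)
    qed simp_all
  qed
  \<comment> \<open>Two events, each with a factor 2000 from the \<open>+ 1\<close> in the exponent
    \<open>k + 1\<close>.\<close>
  also have "\<dots> = 4000 * (1.0005 ^ n * 2000 ^ k * 0.998 ^ n)"
    by (simp add: power_one_over divide_simps)
  also have "\<dots> \<le> 4000 * (1.0005 ^ n * 1.0004 ^ n * 0.998 ^ n)"
    using separator_count_le[OF k] by (intro mult_left_mono mult_right_mono) auto
  also have "\<dots> = 4000 * (1.0005 * 1.0004 * 0.998) ^ n"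
    by (simp only: power_mult_distrib)
  also have "\<dots> \<le> 4000 * 0.999 ^ n"
    by (intro mult_left_mono power_mono) auto
  finally show ?thesis .
qed

section \<open>Passage to the limit\<close>

theorem theorem1:
  fixes c :: real
  assumes "c \<ge> 1.073"
  shows "\<exists>\<beta>::real. \<beta> > 0 \<and>
    (\<lambda>n. measure_pmf.prob (erdos_renyi n (nat \<lfloor>c * real n\<rfloor>))
            {E. real (treewidth {..<n} E) > \<beta> * real n}) \<longlonglongrightarrow> 1"
proof (intro exI conjI)
  let ?p = "\<lambda>n. measure_pmf.prob (erdos_renyi n (nat \<lfloor>c * real n\<rfloor>))
            {E. real (treewidth {..<n} E) > 1 / 100000 * real n}"
  have c: "1073 / 1000 \<le> c" using assms by simp
  \<comment> \<open>From this threshold on, \<open>c * n\<close> is at most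
    \<open>n choose 2\<close>, so the random graph is well defined.\<close>
  have bound: "1 - 4000 * 0.999 ^ n \<le> ?p n" if n: "n \<ge> nat \<lceil>2 * c + 10000\<rceil>" for n
  proof -
    let ?m = "nat \<lfloor>c * real n\<rfloor>"
    have rn: "2 * c + 10000 \<le> real n" using n by linarith
    have n1: "10000 \<le> n" using rn c by linarith
    have "1073 / 1000 * real n \<le> c * real n" using c by (intro mult_right_mono) auto
    \<comment> \<open>Since \<open>14 * 1.073 = 15.022\<close>, the surplus \<open>0.022 * n\<close>
      absorbs the loss of less than 14 caused by rounding down.\<close>
    then have "15 * real n \<le> 14 * real ?m" using n1 by linarith
    then have m1: "15 * n \<le> 14 * ?m" by linarith
    have "real (n choose 2) = real n * (real n - 1) / 2"
      using n1 by (simp add: choose_two real_of_nat_div of_nat_diff)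
    moreover have "c * real n \<le> (real n - 1) / 2 * real n"
      using rn by (intro mult_right_mono) auto
    ultimately have "c * real n \<le> real (n choose 2)" by (simp add: mult.commute)
    then have m2: "?m \<le> n choose 2" by linarith
    have "?p n = 1 - measure_pmf.prob (erdos_renyi n ?m) {E. real (treewidth {..<n} E) \<le> 1 / 100000 * n}"
      by (subst measure_pmf.prob_compl[symmetric]) (auto intro!: arg_cong[where f = "measure_pmf.prob _"])
    then show ?thesis using prob_small_treewidth_le[OF n1 m1 m2] by simp
  qed
  show "?p \<longlonglongrightarrow> 1"
  proof (rule tendsto_sandwich)
    show "eventually (\<lambda>n. 1 - 4000 * 0.999 ^ n \<le> ?p n) sequentially"
      using bound eventually_sequentially by blast
    show "eventually (\<lambda>n. ?p n \<le> 1) sequentially" by simp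
    have "(\<lambda>n. 0.999 ^ n :: real) \<longlonglongrightarrow> 0" by (rule LIMSEQ_realpow_zero) auto
    then have "(\<lambda>n. 1 - 4000 * 0.999 ^ n :: real) \<longlonglongrightarrow> 1 - 4000 * 0"
      by (intro tendsto_diff tendsto_mult tendsto_const)
    then show "(\<lambda>n. 1 - 4000 * 0.999 ^ n :: real) \<longlonglongrightarrow> 1" by simp
  qed simp
qed simp

end
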